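(* For $n\geq 4$, $a_n(123;213) = \lceil n/2\rceil + 1$.
   Context: $\mathcal{S}_n$ is the set of permutations of $[n]=\{1,\dots,n\}$, written in one-line notation $\pi=\pi_1\pi_2\cdots\pi_n$ with $\pi_i=\pi(i)$. A permutation is cyclic if it consists of exactly one $n$-cycle. For a cyclic $\pi$, its standard cycle notation is $C(\pi)=(c_1,c_2,\dots,c_n)$ with $c_1=1$ and $c_i=\pi_{c_{i-1}}$ for $2\le i\le n$. A sequence of distinct integers $w_1\cdots w_m$ contains a pattern $\sigma\in\mathcal{S}_k$ if there are indices $i_1<\dots<i_k$ with $w_{i_1}\cdots w_{i_k}$ in the same relative order as $\sigma_1\cdots\sigma_k$; otherwise it avoids $\sigma$. For $\sigma,\tau\in\mathcal{S}_3$, $\mathcal{A}_n(\sigma;\tau)$ is the set of cyclic permutations $\pi\in\mathcal{S}_n$ whose one-line notation avoids $\sigma$ and whose cycle notation $C(\pi)$ (as the sequence $c_1c_2\cdots c_n$) avoids $\tau$; $a_n(\sigma;\tau)=|\mathcal{A}_n(\sigma;\tau)|$. *)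

theory Defs
  imports Complex_Main "HOL-Library.Sublist" "HOL-Combinatorics.Permutations" "HOL-Combinatorics.Orbits"
begin

text \<open>A permutation of \<open>[n]\<close> is a function \<^term>\<open>p :: nat \<Rightarrow> nat\<close> with \<^prop>\<open>p permutes {1..n}\<close>; being the
  identity outside \<open>{1..n}\<close>, it is determined by its one-line notation. It is a single \<open>n\<close>-cycle
  iff \<^prop>\<open>cyclic_on p {1..n}\<close>. Patterns are given by their one-line notation.\<close>

definition one_line :: "nat \<Rightarrow> (nat \<Rightarrow> nat) \<Rightarrow> nat list" where
  "one_line n p = map p [1..<Suc n]"

text \<open>The list index starts at \<open>0\<close>, so the entry at index \<open>i\<close> is \<open>c\<^sub>i\<^sub>+\<^sub>1\<close>.\<close>

definition cycle_notation :: "nat \<Rightarrow> (nat \<Rightarrow> nat) \<Rightarrow> nat list" where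
  "cycle_notation n p = map (\<lambda>i. (p ^^ i) 1) [0..<n]"

lemma cycle_notation_0: "0 < n \<Longrightarrow> cycle_notation n p ! 0 = 1"
  by (simp add: cycle_notation_def)

lemma cycle_notation_Suc:
  "Suc i < n \<Longrightarrow> cycle_notation n p ! Suc i = p (cycle_notation n p ! i)"
  by (simp add: cycle_notation_def)

definition same_relative_order :: "nat list \<Rightarrow> nat list \<Rightarrow> bool" where
  "same_relative_order v s \<longleftrightarrow> length v = length s \<and>
     (\<forall>i < length s. \<forall>j < length s. v ! i < v ! j \<longleftrightarrow> s ! i < s ! j)"

text \<open>\<^const>\<open>subseq\<close> is the relation of being a not necessarily contiguous subsequence.\<close>

definition contains_pattern :: "nat list \<Rightarrow> nat list \<Rightarrow> bool" where
  "contains_pattern w s \<longleftrightarrow> (\<exists>v. subseq v w \<and> same_relative_order v s)"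

definition avoids_pattern :: "nat list \<Rightarrow> nat list \<Rightarrow> bool" where
  "avoids_pattern w s \<longleftrightarrow> \<not> contains_pattern w s"

definition cyclic_avoiders :: "nat \<Rightarrow> nat list \<Rightarrow> nat list \<Rightarrow> (nat \<Rightarrow> nat) set" where
  "cyclic_avoiders n s t =
     {p. p permutes {1..n} \<and> cyclic_on p {1..n} \<and>
         avoids_pattern (one_line n p) s \<and> avoids_pattern (cycle_notation n p) t}"

definition num_cyclic_avoiders :: "nat \<Rightarrow> nat list \<Rightarrow> nat list \<Rightarrow> nat" where
  "num_cyclic_avoiders n s t = card (cyclic_avoiders n s t)"

end

theory Submission
  imports Defs
begin

text \<open>The entries of \<open>C(\<pi>)\<close> up to \<open>n\<close> increase and are a run of consecutive values
  \<open>1 < \<pi>(1) < \<dots>\<close> under \<open>\<pi>\<close>, so avoiding 123 forces \<open>n\<close> to be the second or third entry.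

  If \<open>\<pi>(1) = n\<close>, then \<open>\<pi>(n) = 2\<close>, and deleting \<open>1\<close> and \<open>n\<close> from \<open>C(\<pi>)\<close> is a bijection onto
  the avoiders of size \<open>n - 2\<close>. If \<open>C(\<pi>) = (1, 2, n, \<dots>)\<close>, the entries of \<open>\<pi>\<close> greater than 2 are
  decreasing, so only the position of the value 1 is free, and every position but one creates a
  2-cycle; the survivor is \<open>C(\<pi>) = (1, 2, n, 3, n - 1, \<dots>)\<close>. If \<open>C(\<pi>) = (1, j, n, \<dots>)\<close> with
  \<open>j > 2\<close>, then \<open>j = n - 1\<close>, and this happens only for \<open>(1, 3, 4, 2)\<close> and \<open>(1, 4, 5, 2, 3)\<close>.
  Hence \<open>a\<^sub>n = a\<^sub>n\<^sub>-\<^sub>2 + 1\<close> for \<open>n \<ge> 6\<close>.\<close>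

section \<open>Patterns of length three in terms of indices\<close>

lemma subseq_three_iff:
  "subseq [x, y, z] w \<longleftrightarrow>
     (\<exists>i j k. i < j \<and> j < k \<and> k < length w \<and> x = w ! i \<and> y = w ! j \<and> z = w ! k)"
proof
  assume "subseq [x, y, z] w"
  then obtain u1 w1 where 1: "w = u1 @ x # w1" "subseq [y, z] w1"
    by (blast dest: list_emb_ConsD)
  then obtain u2 w2 where 2: "w1 = u2 @ y # w2" "subseq [z] w2"
    by (blast dest: list_emb_ConsD)
  then obtain u3 w3 where 3: "w2 = u3 @ z # w3"
    by (blast dest: list_emb_ConsD)
  let ?i = "length u1" and ?j = "length u1 + 1 + length u2"
    and ?k = "length u1 + 1 + length u2 + 1 + length u3"
  have "?i < ?j \<and> ?j < ?k \<and> ?k < length w \<and> x = w ! ?i \<and> y = w ! ?j \<and> z = w ! ?k"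
    using 1 2 3 by (simp add: nth_append)
  then show "\<exists>i j k. i < j \<and> j < k \<and> k < length w \<and> x = w ! i \<and> y = w ! j \<and> z = w ! k"
    by blast
next
  assume "\<exists>i j k. i < j \<and> j < k \<and> k < length w \<and> x = w ! i \<and> y = w ! j \<and> z = w ! k"
  then obtain i j k where *: "i < j" "j < k" "k < length w" "x = w ! i" "y = w ! j" "z = w ! k"
    by blast
  \<comment> \<open>The claim is proved for indices first; mapping \<open>(!) w\<close> over both
    lists transfers it to the entries.\<close>
  have "subseq [i, j, k] [0..<length w]"
    using * by (intro sorted_subset_imp_subseq) auto
  then have "subseq (map ((!) w) [i, j, k]) (map ((!) w) [0..<length w])"
    by (rule subseq_map)
  then show "subseq [x, y, z] w"
    using * by (simp add: map_nth)
qed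

lemma contains_three_iff:
  "contains_pattern w [a, b, c] \<longleftrightarrow>
     (\<exists>i j k. i < j \<and> j < k \<and> k < length w \<and> same_relative_order [w ! i, w ! j, w ! k] [a, b, c])"
proof
  assume "contains_pattern w [a, b, c]"
  then obtain v where v: "subseq v w" "same_relative_order v [a, b, c]"
    by (auto simp: contains_pattern_def)
  then have "length v = 3" by (simp add: same_relative_order_def)
  then obtain x y z where "v = [x, y, z]"
    by (auto simp: numeral_3_eq_3 length_Suc_conv)
  with v show "\<exists>i j k. i < j \<and> j < k \<and> k < length w \<and>
      same_relative_order [w ! i, w ! j, w ! k] [a, b, c]"
    by (auto simp: subseq_three_iff)
next
  assume "\<exists>i j k. i < j \<and> j < k \<and> k < length w \<and>
      same_relative_order [w ! i, w ! j, w ! k] [a, b, c]"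
  then obtain i j k where "i < j" "j < k" "k < length w"
    and rel: "same_relative_order [w ! i, w ! j, w ! k] [a, b, c]"
    by blast
  then have "subseq [w ! i, w ! j, w ! k] w"
    unfolding subseq_three_iff by blast
  with rel show "contains_pattern w [a, b, c]"
    unfolding contains_pattern_def by blast
qed

lemma all_less_three: "(\<forall>i<3. P i) \<longleftrightarrow> P 0 \<and> P 1 \<and> P (2::nat)"
proof -
  have "i < 3 \<longleftrightarrow> i = 0 \<or> i = 1 \<or> i = 2" for i :: nat by arith
  then show ?thesis by metis
qed

lemma order_123_iff: "same_relative_order [x, y, z] [1, 2, 3] \<longleftrightarrow> x < y \<and> y < z"
  proof -
  \<comment> \<open>This turns the bound of the quantifiers into the numeral 3, so that
    \<open>all_less_three\<close> applies.\<close>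
  have "length [a, b, c] = 3" for a b c :: nat by simp
  then show ?thesis
    unfolding same_relative_order_def by (simp only: all_less_three) (simp, linarith)
qed

lemma order_213_iff: "same_relative_order [x, y, z] [2, 1, 3] \<longleftrightarrow> y < x \<and> x < z"
  proof -
  have "length [a, b, c] = 3" for a b c :: nat by simp
  then show ?thesis
    unfolding same_relative_order_def by (simp only: all_less_three) (simp, linarith)
qed

lemma avoids_123_iff:
  "avoids_pattern (one_line n p) [1, 2, 3] \<longleftrightarrow>
     (\<forall>i j k. 1 \<le> i \<and> i < j \<and> j < k \<and> k \<le> n \<longrightarrow> \<not> (p i < p j \<and> p j < p k))" (is "?L \<longleftrightarrow> ?R")
proof
  assume ?L
  show ?R
  proof (intro allI impI notI)
    fix i j k assume ijk: "1 \<le> i \<and> i < j \<and> j < k \<and> k \<le> n" and inc: "p i < p j \<and> p j < p k"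
    have "i - 1 < j - 1 \<and> j - 1 < k - 1 \<and> k - 1 < length (one_line n p) \<and>
       same_relative_order [one_line n p ! (i - 1), one_line n p ! (j - 1), one_line n p ! (k - 1)] [1, 2, 3]"
      unfolding order_123_iff using ijk inc by (auto simp: one_line_def simp del: upt_Suc)
    then show False using \<open>?L\<close> unfolding avoids_pattern_def contains_three_iff by blast
  qed
next
  assume R: ?R
  show ?L
    unfolding avoids_pattern_def contains_three_iff order_123_iff
  proof (intro notI, elim exE conjE)
    fix i j k
    assume "i < j" "j < k" "k < length (one_line n p)"
      "one_line n p ! i < one_line n p ! j" "one_line n p ! j < one_line n p ! k"
    then show False using R[rule_format, of "Suc i" "Suc j" "Suc k"]
      by (auto simp: one_line_def simp del: upt_Suc)
  qed
qed

lemma avoids_213_iff: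
  "avoids_pattern (cycle_notation n p) [2, 1, 3] \<longleftrightarrow>
     (\<forall>i j k. i < j \<and> j < k \<and> k < n \<longrightarrow>
        \<not> ((p ^^ j) 1 < (p ^^ i) 1 \<and> (p ^^ i) 1 < (p ^^ k) 1))"
proof -
  have *: "i < j \<and> j < k \<and> k < length (cycle_notation n p) \<and>
      cycle_notation n p ! j < cycle_notation n p ! i \<and> cycle_notation n p ! i < cycle_notation n p ! k
    \<longleftrightarrow> (i < j \<and> j < k \<and> k < n) \<and> (p ^^ j) 1 < (p ^^ i) 1 \<and> (p ^^ i) 1 < (p ^^ k) 1" for i j k
    by (auto simp: cycle_notation_def)
  show ?thesis
    unfolding avoids_pattern_def contains_three_iff order_213_iff * by blast
qed

section \<open>Cyclic permutations through the iterates of 1\<close>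

text \<open>The right-hand side speaks only of the iterates of 1, which can be computed for explicit
  permutations. It suffices because every value then has its predecessor in the cycle as a preimage,
  and a surjection of the finite set \<open>{1..n}\<close> onto itself is a bijection.\<close>

lemma cyclic_permutation_iff:
  fixes p :: "nat \<Rightarrow> nat"
  assumes "n \<ge> 1"
  shows "p permutes {1..n} \<and> cyclic_on p {1..n} \<longleftrightarrow>
    (\<forall>x. x \<notin> {1..n} \<longrightarrow> p x = x) \<and> (\<lambda>i. (p ^^ i) 1) ` {..<n} = {1..n} \<and> (p ^^ n) 1 = 1"
    (is "?L \<longleftrightarrow> ?out \<and> ?img \<and> ?close")
proof
  assume L: ?L
  have one: "1 \<in> {1..n}" using assms by simp
  with L have orb: "orbit p 1 = {1..n}" by (simp add: orbit_cyclic_eq3)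
  then have self: "1 \<in> orbit p 1" using one by simp
  \<comment> \<open>\<open>d\<close> is the first return time to 1. The iterates before it are
    distinct and fill the orbit, so \<open>d = n\<close>.\<close>
  define d where "d = funpow_dist1 p 1 1"
  have close: "(p ^^ d) 1 = 1"
    unfolding d_def by (rule funpow_dist1_prop[OF self])
  have "(\<lambda>i. (p ^^ i) 1) ` {0..<d} = {1..n}"
    unfolding d_def using orbit_conv_funpow_dist1[OF self] orb by simp
  moreover from this have "card {1..n} = d"
    using card_image[OF inj_on_funpow_dist1[OF self]] by (simp add: d_def)
  ultimately have "d = n" "(\<lambda>i. (p ^^ i) 1) ` {..<n} = {1..n}"
    by (auto simp: lessThan_atLeast0)
  then show "?out \<and> ?img \<and> ?close"
    using L close by (auto simp: permutes_def)
next
  assume R: "?out \<and> ?img \<and> ?close"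
  have range: "(p ^^ i) 1 \<in> {1..n}" if "i \<le> n" for i
  proof (cases "i = n")
    case True
    with R have "(p ^^ i) 1 = 1" by simp
    with assms show ?thesis by simp
  next
    case False
    with that have "(p ^^ i) 1 \<in> (\<lambda>i. (p ^^ i) 1) ` {..<n}" by simp
    with R show ?thesis by metis
  qed
  have hit: "\<exists>i<n. x = (p ^^ i) 1" if "x \<in> {1..n}" for x
  proof -
    from that R have "x \<in> (\<lambda>i. (p ^^ i) 1) ` {..<n}" by metis
    then show ?thesis by blast
  qed
  have "p ` {1..n} = {1..n}"
  proof
    show "p ` {1..n} \<subseteq> {1..n}"
    proof
      fix y assume "y \<in> p ` {1..n}"
      then obtain i where "i < n" "y = p ((p ^^ i) 1)" using hit by blast
      then show "y \<in> {1..n}" using range[of "Suc i"] by simp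
    qed
    show "{1..n} \<subseteq> p ` {1..n}"
    proof
      fix y assume "y \<in> {1..n}"
      then obtain i where i: "i < n" "y = (p ^^ i) 1" using hit by blast
      \<comment> \<open>The predecessor of 1 is the last entry of the cycle, by the closing
        condition.\<close>
      obtain l where l: "l < n" "y = (p ^^ Suc l) 1"
      proof (cases i)
        case 0
        then show ?thesis using that[of "n - 1"] i R by simp
      next
        case (Suc l)
        then show ?thesis using that[of l] i by simp
      qed
      show "y \<in> p ` {1..n}"
using l range[of l] by (intro image_eqI) auto
    qed
  qed
  then have "bij_betw p {1..n} {1..n}"
    by (simp add: bij_betw_def eq_card_imp_inj_on)
  then have perm: "p permutes {1..n}"
    using R by (intro bij_imp_permutes) auto
  have "orbit p 1 = {1..n}"
  proof
    show "orbit p 1 \<subseteq> {1..n}"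
      using perm assms by (intro permutes_orbit_subset) auto
    show "{1..n} \<subseteq> orbit p 1"
    proof
      fix x assume "x \<in> {1..n}"
      then obtain i where i: "i < n" "x = (p ^^ i) 1" using hit by blast
      \<comment> \<open>\<open>orbit_altdef\<close> admits positive iterates only, so 1 is written
        as the \<open>n\<close>-th iterate instead of the 0-th.\<close>
      have "x = (p ^^ (if i = 0 then n else i)) 1" using i R by simp
      then show "x \<in> orbit p 1" using assms by (auto simp: orbit_altdef)
    qed
  qed
  then have "cyclic_on p {1..n}"
    using assms by (intro cyclic_on_singleI[of 1]) auto
  with perm show ?L by simp
qed

section \<open>Avoiders and their basic properties\<close>

abbreviation avoiders :: "nat \<Rightarrow> (nat \<Rightarrow> nat) set" where
  "avoiders n \<equiv> cyclic_avoiders n [1, 2, 3] [2, 1, 3]"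

text \<open>Unlike \<open>cycle_notation\<close>, this has no bound on the index, so
  \<open>cyc p n = 1\<close> can express that the cycle closes.\<close>

definition cyc :: "(nat \<Rightarrow> nat) \<Rightarrow> nat \<Rightarrow> nat" where
  "cyc p i = (p ^^ i) 1"

lemma cyc_0 [simp]: "cyc p 0 = 1"
  by (simp add: cyc_def)

lemma cyc_Suc: "cyc p (Suc i) = p (cyc p i)"
  by (simp add: cyc_def)

lemma cyc_1: "cyc p 1 = p 1"
  by (simp add: cyc_def)

lemma cyc_2: "cyc p 2 = p (p 1)"
  by (simp add: cyc_def numeral_2_eq_2)

lemma avoiders_iff:
  assumes "n \<ge> 1"
  shows "p \<in> avoiders n \<longleftrightarrow>
    (\<forall>x. x \<notin> {1..n} \<longrightarrow> p x = x) \<and> cyc p ` {..<n} = {1..n} \<and> cyc p n = 1 \<and>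
    (\<forall>i j k. 1 \<le> i \<and> i < j \<and> j < k \<and> k \<le> n \<longrightarrow> \<not> (p i < p j \<and> p j < p k)) \<and>
    (\<forall>i j k. i < j \<and> j < k \<and> k < n \<longrightarrow> \<not> (cyc p j < cyc p i \<and> cyc p i < cyc p k))"
proof -
  have "cyc p = (\<lambda>i. (p ^^ i) 1)" by (simp add: fun_eq_iff cyc_def)
  then show ?thesis
    unfolding cyclic_avoiders_def mem_Collect_eq conj_assoc[symmetric]
    unfolding cyclic_permutation_iff[OF assms] avoids_123_iff avoids_213_iff
    by (simp only: conj_assoc)
qed

locale avoider =
  fixes n :: nat and p :: "nat \<Rightarrow> nat"
  assumes n_pos: "n \<ge> 1" and avoider: "p \<in> avoiders n"
begin

lemma perm: "p permutes {1..n}"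
  using avoider by (simp add: cyclic_avoiders_def)

lemma outside: "x \<notin> {1..n} \<Longrightarrow> p x = x"
  using perm by (rule permutes_not_in)

lemma in_range: "x \<in> {1..n} \<Longrightarrow> p x \<in> {1..n}"
  using permutes_in_image[OF perm] by blast

lemma inj_iff: "p x = p y \<longleftrightarrow> x = y"
  using permutes_inj[OF perm] by (simp add: inj_eq)

lemma preimage:
  assumes "y \<in> {1..n}"
  obtains x where "x \<in> {1..n}" "p x = y"
  using assms permutes_image[OF perm] by (metis imageE)

lemma cyc_image: "cyc p ` {..<n} = {1..n}"
  using avoider avoiders_iff[OF n_pos] by blast

lemma cyc_n: "cyc p n = 1"
  using avoider avoiders_iff[OF n_pos] by blast

lemma no_123: "\<lbrakk>1 \<le> i; i < j; j < k; k \<le> n; p i < p j; p j < p k\<rbrakk> \<Longrightarrow> False"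
  using avoider unfolding avoiders_iff[OF n_pos] by blast

lemma no_213: "\<lbrakk>i < j; j < k; k < n; cyc p j < cyc p i; cyc p i < cyc p k\<rbrakk> \<Longrightarrow> False"
  using avoider unfolding avoiders_iff[OF n_pos] by blast

lemma cyc_range: "i \<le> n \<Longrightarrow> cyc p i \<in> {1..n}"
  using cyc_image cyc_n n_pos by (cases "i = n") auto

lemma cyc_inj: "\<lbrakk>i < n; j < n\<rbrakk> \<Longrightarrow> cyc p i = cyc p j \<longleftrightarrow> i = j"
proof -
  have "inj_on (cyc p) {..<n}"
    by (intro eq_card_imp_inj_on) (simp_all add: cyc_image)
  then show "\<lbrakk>i < n; j < n\<rbrakk> \<Longrightarrow> cyc p i = cyc p j \<longleftrightarrow> i = j"
    by (simp add: inj_on_eq_iff)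
qed

lemma cyc_surj:
  assumes "x \<in> {1..n}"
  obtains i where "i < n" "cyc p i = x"
  using assms unfolding cyc_image[symmetric] by blast

lemma p_cyc_last: "p (cyc p (n - 1)) = 1"
  using cyc_n n_pos by (metis cyc_Suc Suc_diff_1 less_eq_Suc_le One_nat_def)

section \<open>The first entries of the cycle notation\<close>

text \<open>Otherwise an entry would recur after two steps of a cycle of length at least 3. The
  cases tell how far these steps run past the end of the cycle notation. Fixed points are excluded
  too.\<close>

lemma no_two_cycle:
  assumes "n \<ge> 3" "x \<in> {1..n}"
  shows "p (p x) \<noteq> x"
proof
  assume eq: "p (p x) = x"
  obtain i where i: "i < n" "cyc p i = x" using cyc_surj assms(2) by blast
  have x: "cyc p (Suc (Suc i)) = x" using eq i by (simp add: cyc_Suc)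
  consider "Suc (Suc i) < n" | "Suc (Suc i) = n" | "Suc i = n" using i by linarith
  then show False
  proof cases
    case 1
    then show False using x i cyc_inj[of "Suc (Suc i)" i] by simp
  next
    case 2
    then show False using x i cyc_n cyc_inj[of i 0] assms(1) by simp
  next
    case 3
    then have "cyc p (Suc (Suc i)) = cyc p 1"
      using cyc_n cyc_1 by (metis cyc_Suc)
    then show False using x i 3 cyc_inj[of i 1] assms(1) by simp
  qed
qed

text \<open>Every entry preceding 2 in the cycle notation would play the role of the 2 in a pattern 213
  whose 1 is the entry 2.\<close>

lemma small_after_two:
  assumes "cyc p s = 2" "i < s" "s \<le> k" "k < n" "2 < cyc p i"
  shows "cyc p k < cyc p i"
  using assms no_213[of i s k] cyc_inj[of i k]
  by (cases "k = s"; cases "cyc p i" "cyc p k" rule: linorder_cases) auto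

lemma n_second_or_third:
  assumes "n \<ge> 3" "p 1 \<noteq> n"
  shows "p (p 1) = n"
proof -
  obtain t where t: "t < n" "cyc p t = n" using cyc_surj[of n] n_pos by auto
  \<comment> \<open>A descent before index \<open>t\<close>, followed by the entry \<open>n\<close>
    at \<open>t\<close>, would be a 213.\<close>
  have inc: "cyc p i < cyc p k" if "i < k" "k \<le> t" for i k
  proof (cases "k = t")
    case True
    then show ?thesis using that t cyc_inj[of i t] cyc_range[of i] by auto
  next
    case False
    have "cyc p i < n" using that t cyc_inj[of i t] cyc_range[of i] by auto
    then show ?thesis using that t False no_213[of i k t] cyc_inj[of i k]
      by (cases "cyc p i" "cyc p k" rule: linorder_cases) auto
  qed
  have "\<not> t \<ge> 3"
  proof
    assume 3: "t \<ge> 3"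
    have "cyc p 0 < cyc p 1" "cyc p 1 < cyc p 2" "cyc p 2 < cyc p 3"
      using inc[of 0 1] inc[of 1 2] inc[of 2 3] 3 by simp_all
    moreover have "cyc p 1 = p (cyc p 0)" "cyc p 2 = p (cyc p 1)" "cyc p 3 = p (cyc p 2)"
      using cyc_Suc[of p 0] cyc_Suc[of p 1] cyc_Suc[of p 2] by (simp_all add: numeral_eq_Suc)
    moreover have "cyc p 2 \<le> n" using cyc_range[of 2] assms by simp
    \<comment> \<open>Cycle entries serve as positions and, one step later, as values; four
      increasing entries therefore give a 123 in one-line notation.\<close>
    ultimately show False using no_123[of "cyc p 0" "cyc p 1" "cyc p 2"] by simp
  qed
  moreover have "t \<noteq> 0" using t assms by (cases t) auto
  moreover have "t \<noteq> 1" using t assms cyc_1[of p] by auto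
  ultimately have "t = 2" by linarith
  then show ?thesis using t cyc_2[of p] by simp
qed

text \<open>A counting argument. If \<open>m = p n\<close> exceeds 2, the last cycle entry
  \<open>x\<close>, which is the position of the value 1, is less than \<open>m\<close>. But
  avoiding 123 forces the \<open>m - 2\<close> values from 2 to \<open>m - 1\<close> into the
  \<open>x - 2\<close> positions from 2 to \<open>x - 1\<close>.\<close>

lemma two_third:
  assumes "n \<ge> 3" "p 1 = n"
  shows "p n = 2"
proof (rule ccontr)
  assume ne: "p n \<noteq> 2"
  define m where "m = p n"
  have c1: "cyc p 1 = n" and c2: "cyc p 2 = m"
    using assms cyc_1[of p] cyc_2[of p] by (simp_all add: m_def)
  have m: "3 \<le> m" "m < n"
  proof -
    have "m \<in> {1..n}" using cyc_range[of 2] c2 assms by simp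
    moreover have "m \<noteq> 1" using cyc_inj[of 2 0] c2 assms by simp
    moreover have "m \<noteq> n" using cyc_inj[of 2 1] c1 c2 assms by simp
    ultimately show "3 \<le> m" "m < n" using ne by (auto simp: m_def)
  qed
  obtain s where s: "s < n" "cyc p s = 2" using cyc_surj[of 2] assms by auto
  have "s \<noteq> 0" using s by (cases s) auto
  moreover have "s \<noteq> 1" using s(2) c1 m by auto
  moreover have "s \<noteq> 2" using s(2) c2 m by auto
  ultimately have s3: "2 < s" by linarith
  define x where "x = cyc p (n - 1)"
  have px: "p x = 1" using p_cyc_last by (simp add: x_def)
  have "x < m" using small_after_two[of s 2 "n - 1"] s s3 c2 m by (simp add: x_def)
  define f where "f = inv p"
  have f: "f v \<in> {1..n} \<and> p (f v) = v" if "v \<in> {1..n}" for v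
    unfolding f_def using that permutes_inverses(1)[OF perm] permutes_in_image[OF permutes_inv[OF perm]]
    by blast
  have "f ` {2..<m} \<subseteq> {2..<x}"
  proof
    fix y assume "y \<in> f ` {2..<m}"
    then obtain v where v: "v \<in> {2..<m}" "y = f v" by blast
    then have y: "y \<in> {1..n}" "p y = v" using f[of v] m by auto
    have "y \<noteq> 1" "y \<noteq> n" "y \<noteq> x" using y v px assms m by (auto simp: m_def)
    \<comment> \<open>The positions \<open>x < y < n\<close> would carry the values
      \<open>1 < v < m\<close>.\<close>
    moreover have "\<not> x < y"
      using no_123[of x y n] y v px m calculation cyc_range[of "n - 1"] by (auto simp: m_def x_def)
    ultimately show "y \<in> {2..<x}" using y by auto
  qed
  moreover have "inj_on f {2..<m}"
    unfolding f_def by (rule permutes_inj_on[OF permutes_inv[OF perm]])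
  ultimately have "card {2..<m} \<le> card {2..<x}"
    by (metis card_image card_mono finite_atLeastLessThan)
  with \<open>x < m\<close> m show False by simp
qed

end

section \<open>The case where the cycle notation begins with 1, 2, \<open>n\<close>\<close>

text \<open>One-line form of the cycle (1, 2, n, 3, n - 1, ...), whose last entry is
  \<open>(n + 3) div 2\<close>.\<close>

definition zigzag :: "nat \<Rightarrow> nat \<Rightarrow> nat" where
  "zigzag n i =
     (if i \<notin> {1..n} then i
      else if i = 1 then 2
      else if i = (n + 3) div 2 then 1
      else if i < (n + 3) div 2 then n + 2 - i
      else n + 3 - i)"

lemma (in avoider) eq_zigzag:
  assumes "n \<ge> 3" "p 1 = 2" "p 2 = n"
  shows "p = zigzag n"
proof -
  obtain q where q: "q \<in> {1..n}" "p q = 1" using preimage[of 1] assms by auto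
  have "q \<noteq> 1" "q \<noteq> 2" using q assms by auto
  then have q3: "3 \<le> q" "q \<le> n" using q by auto
  have ge: "3 \<le> p i" if "i \<in> {2..n}" "i \<noteq> q" for i
  proof -
    have "p i \<noteq> 1" "p i \<noteq> 2" "p i \<in> {1..n}"
      using that q assms inj_iff[of i q] inj_iff[of i 1] in_range[of i] by auto
    then show ?thesis by auto
  qed
  \<comment> \<open>An ascent among these values would complete a 123 starting with
    \<open>p 1 = 2\<close>.\<close>
  have dec: "p k < p i" if "2 \<le> i" "i < k" "k \<le> n" "i \<noteq> q" "k \<noteq> q" for i k
    using that ge[of i] no_123[of 1 i k] inj_iff[of i k] assms
    by (cases "p i" "p k" rule: linorder_cases) auto
  \<comment> \<open>\<open>L\<close> is the one-line notation without the entries 2 and 1; it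
    decreases and has the values from 3 to \<open>n\<close>, so it is determined.\<close>
  define L where "L = map p ([2..<q] @ [Suc q..<Suc n])"
  have "rev L = [3..<Suc n]"
  proof (rule strict_sorted_equal)
    have "sorted_wrt (\<lambda>i k. p k < p i) ([2..<q] @ [Suc q..<Suc n])"
      using dec q3 by (auto simp: sorted_wrt_append sorted_wrt_iff_nth_less nth_append simp del: upt_Suc)
    then show "sorted_wrt (<) (rev L)"
      unfolding L_def sorted_wrt_rev by (simp only: sorted_wrt_map)
    have "{2..<q} \<union> {Suc q..<Suc n} = {1..n} - {1, q}"
      using q3 by auto
    then have "set (rev L) = p ` ({1..n} - {1, q})"
      unfolding L_def by (simp only: set_rev set_map set_append set_upt)
    also have "\<dots> = p ` {1..n} - p ` {1, q}"
      by (rule image_set_diff) (rule permutes_inj[OF perm])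
    also have "\<dots> = {1..n} - {2, 1}"
      using permutes_image[OF perm] q assms by simp
    finally have "set (rev L) = {1..n} - {2, 1}" .
    moreover have "{3..<Suc n} = {1..n} - {2, 1}" by auto
    ultimately show "set (rev L) = set [3..<Suc n]" by (simp only: set_upt)
  qed (rule sorted_wrt_upt)
  then have L: "L = rev [3..<Suc n]" by (metis rev_rev_ident)
  have before: "p i = n + 2 - i" if "2 \<le> i" "i < q" for i
  proof -
    \<comment> \<open>Position 2 has list index 0. Beyond \<open>q\<close> the index is
      \<open>i - 3\<close>, since \<open>q\<close> is left out of \<open>L\<close>.\<close>
    have "Suc (Suc (i - 2)) = i" "i - 2 < q - 2" using that by simp_all
    then have "p i = L ! (i - 2)" using q3 by (simp add: L_def nth_append del: upt_Suc)
    then show ?thesis using that q3 by (simp add: L rev_nth del: upt_Suc)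
  qed
  have after: "p i = n + 3 - i" if "q < i" "i \<le> n" for i
  proof -
    have "\<not> i - 3 < q - 2" using that q3 by linarith
    then have "p i = L ! (i - 3)" using that q3 by (simp add: L_def nth_append del: upt_Suc)
    then show ?thesis using that q3 by (simp add: L rev_nth del: upt_Suc)
  qed
  \<comment> \<open>Otherwise \<open>q - 1\<close> and \<open>n + 3 - q\<close> both lie left of
    \<open>q\<close>, where the reflection taking \<open>i\<close> to \<open>n + 2 - i\<close>
    exchanges them.\<close>
  have "\<not> n + 4 \<le> 2 * q"
  proof
    assume "n + 4 \<le> 2 * q"
    then have "2 \<le> n + 3 - q" "n + 3 - q < q" "2 \<le> q - 1" "q - 1 < q"
      using q3 by linarith+
    then have "p (q - 1) = n + 2 - (q - 1)" "p (n + 3 - q) = n + 2 - (n + 3 - q)"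
      using before by blast+
    moreover have "n + 2 - (q - 1) = n + 3 - q" "n + 2 - (n + 3 - q) = q - 1"
      using q3 by linarith+
    ultimately have "p (p (q - 1)) = q - 1" by (simp only:)
    moreover have "q - 1 \<in> {1..n}" using q3 by auto
    ultimately show False using no_two_cycle assms(1) by blast
  qed
  \<comment> \<open>Symmetrically, \<open>q + 1\<close> and \<open>n + 2 - q\<close> would both lie
    right of \<open>q\<close> and be exchanged by the reflection taking \<open>i\<close> to
    \<open>n + 3 - i\<close>.\<close>
  moreover have "\<not> 2 * q \<le> n + 1"
  proof
    assume "2 * q \<le> n + 1"
    then have "q < n + 2 - q" "n + 2 - q \<le> n" "q < q + 1" "q + 1 \<le> n"
      using q3 by linarith+
    then have "p (q + 1) = n + 3 - (q + 1)" "p (n + 2 - q) = n + 3 - (n + 2 - q)"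
      using after by blast+
    moreover have "n + 3 - (q + 1) = n + 2 - q" "n + 3 - (n + 2 - q) = q + 1"
      using q3 by linarith+
    ultimately have "p (p (q + 1)) = q + 1" by (simp only:)
    moreover have "q + 1 \<in> {1..n}" using \<open>q + 1 \<le> n\<close> by simp
    ultimately show False using no_two_cycle assms(1) by blast
  qed
  ultimately have "q = (n + 3) div 2" by linarith
  then show ?thesis
    using assms q before after outside q3
    by (intro ext) (auto simp: zigzag_def not_less_eq_eq)
qed

lemma cyc_zigzag:
  assumes "n \<ge> 3" "i < n"
  shows "cyc (zigzag n) i = (if i = 0 then 1 else if odd i then i div 2 + 2 else n + 1 - i div 2)"
  using assms(2)
proof (induction i)
  case (Suc i)
  then have IH: "cyc (zigzag n) i = (if i = 0 then 1 else if odd i then i div 2 + 2 else n + 1 - i div 2)"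
    by simp
  consider "i = 0" | a where "i = 2 * a + 1" | a where "i = 2 * a" "a > 0"
    by (metis evenE oddE gr0I mult_0_right)
  then show ?case
  proof cases
    case 1
    then show ?thesis using assms(1) by (simp add: cyc_Suc zigzag_def)
  next
    case 2
    then have "cyc (zigzag n) (Suc i) = zigzag n (a + 2)" using IH by (simp add: cyc_Suc)
    \<comment> \<open>\<open>Suc i < n\<close> puts the position \<open>a + 2\<close> left of the
      middle; in the next case it puts \<open>n + 1 - a\<close> right of it.\<close>
    also have "\<dots> = n - a" using 2 Suc.prems by (auto simp: zigzag_def)
    finally show ?thesis using 2 Suc.prems by simp
  next
    case 3
    then have "cyc (zigzag n) (Suc i) = zigzag n (n + 1 - a)" using IH by (simp add: cyc_Suc)
    also have "\<dots> = a + 2" using 3 Suc.prems by (auto simp: zigzag_def)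
    finally show ?thesis using 3 Suc.prems by simp
  qed
qed simp

lemma zigzag_avoider:
  assumes "n \<ge> 3"
  shows "zigzag n \<in> avoiders n"
proof -
  let ?z = "zigzag n"
  note cz = cyc_zigzag[OF assms]
  have "cyc ?z ` {..<n} = {1..n}"
  proof
    show "cyc ?z ` {..<n} \<subseteq> {1..n}" using assms by (auto simp: cz elim!: evenE)
    show "{1..n} \<subseteq> cyc ?z ` {..<n}"
    proof
      fix x assume x: "x \<in> {1..n}"
      \<comment> \<open>The small values 2, 3, ... stand at odd indices and the large values n, n -
        1, ... at positive even indices; the inequality decides which kind \<open>x\<close>
        is.\<close>
      consider "x = 1" | "x \<ge> 2" "2 * (x - 2) + 1 < n" | "x \<ge> 2" "n \<le> 2 * (x - 2) + 1"
        using x by force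
      then show "x \<in> cyc ?z ` {..<n}"
      proof cases
        case 1
        then show ?thesis using assms by (intro image_eqI[of _ _ 0]) auto
      next
        case 2
        then show ?thesis by (intro image_eqI[of _ _ "2 * (x - 2) + 1"]) (auto simp: cz)
      next
        case 3
        then show ?thesis using x assms
          by (intro image_eqI[of _ _ "2 * (n + 1 - x)"]) (auto simp: cz)
      qed
    qed
  qed
  moreover have "cyc ?z n = 1"
  proof -
    obtain m where m: "n = Suc m" using assms by (cases n) auto
    \<comment> \<open>For either parity, the last entry is the position of the value 1.\<close>
    then have "cyc ?z m = (n + 3) div 2"
      using assms cz[of m] by (auto elim!: evenE oddE)
    then have "cyc ?z n = ?z ((n + 3) div 2)" by (simp add: m cyc_Suc)
    moreover have "1 < (n + 3) div 2" "(n + 3) div 2 \<le> n" using assms by linarith+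
    ultimately show ?thesis by (simp add: zigzag_def)
  qed
  moreover have "\<not> (?z i < ?z j \<and> ?z j < ?z k)"
    if "1 \<le> i \<and> i < j \<and> j < k \<and> k \<le> n" for i j k
    using that by (auto simp: zigzag_def split: if_splits)
  moreover have "\<not> (cyc ?z j < cyc ?z i \<and> cyc ?z i < cyc ?z k)"
    if "i < j \<and> j < k \<and> k < n" for i j k
    using that by (auto simp: cz elim!: evenE oddE split: if_splits)
  moreover have "\<forall>x. x \<notin> {1..n} \<longrightarrow> ?z x = x" by (simp add: zigzag_def)
  moreover have "1 \<le> n" using assms by simp
  ultimately show ?thesis using avoiders_iff[of n ?z] by blast
qed

section \<open>The case where the cycle notation begins with 1, \<open>j\<close>, \<open>n\<close>
  for some \<open>j > 2\<close>\<close>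

text \<open>The updates are listed in cycle order, so they spell out (1, 3, 4, 2) and (1, 4, 5, 2,
  3).\<close>

definition exceptional :: "nat \<Rightarrow> (nat \<Rightarrow> nat) set" where
  "exceptional n =
     (if n = 4 then {id(1 := 3, 3 := 4, 4 := 2, 2 := 1)}
      else if n = 5 then {id(1 := 4, 4 := 5, 5 := 2, 2 := 3, 3 := 1)}
      else {})"

text \<open>The values decrease on the positions strictly between 1 and \<open>j\<close> and again
  beyond \<open>j\<close>. This places the value 1 at \<open>j - 1\<close>, then forces
  \<open>j = n - 1\<close>, and for \<open>n\<close> at least 5 makes the cycle (1, n - 1, n, 2, n -
  2), which has length 5.\<close>

lemma (in avoider) in_exceptional:
  assumes "p 1 = j" "2 < j" "j < n" "p j = n"
  shows "p \<in> exceptional n"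
proof -
  have n4: "n \<ge> 4" using assms by simp
  define m where "m = p n"
  have c1: "cyc p 1 = j" and c2: "cyc p 2 = n" and c3: "cyc p 3 = m"
    using assms cyc_1[of p] cyc_2[of p] cyc_Suc[of p 2] by (simp_all add: m_def numeral_3_eq_3 numeral_2_eq_2)
  obtain s where s: "s < n" "cyc p s = 2" using cyc_surj[of 2] n4 by auto
  have "s \<noteq> 0" using s by (cases s) auto
  moreover have "s \<noteq> 1" using s(2) c1 assms(2) by auto
  moreover have "s \<noteq> 2" using s(2) c2 n4 by auto
  ultimately have s3: "2 < s" by linarith
  define x where "x = cyc p (n - 1)"
  have px: "p x = 1" using p_cyc_last by (simp add: x_def)
  have "x < j" using small_after_two[of s 1 "n - 1"] s s3 c1 assms by (simp add: x_def)
  have "1 \<le> x" using cyc_range[of "n - 1"] by (simp add: x_def)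
  \<comment> \<open>A larger value would lie between \<open>p 1 = j\<close> and
    \<open>p j = n\<close>; likewise, an ascent before \<open>j\<close> would be completed by
    \<open>p j = n\<close>.\<close>
  have small: "p i < j" if "2 \<le> i" "i < j" for i
    using that assms no_123[of 1 i j] inj_iff[of i 1] inj_iff[of i j] in_range[of i]
    by (cases "p i" j rule: linorder_cases) auto
  have dec: "p k < p i" if "2 \<le> i" "i < k" "k < j" for i k
    using that assms no_123[of i k j] inj_iff[of i k] small[of k]
    by (cases "p i" "p k" rule: linorder_cases) auto
  have "x \<noteq> 1" using px assms by auto
  moreover have "j - 1 \<in> {1..n}" using assms(2,3) by auto
  then have "p (j - 1) \<ge> 1" using in_range atLeastAtMost_iff by blast
  \<comment> \<open>The values decrease up to position \<open>j - 1\<close>, so the least value 1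
    can only stand there.\<close>
  ultimately have "x = j - 1"
    using dec[of x "j - 1"] \<open>x < j\<close> \<open>1 \<le> x\<close> px by (cases "x < j - 1") simp_all
  then have pj: "p (j - 1) = 1" using px by simp
  \<comment> \<open>The value 1 at position \<open>j - 1\<close> turns any later ascent into a
    123.\<close>
  have dec': "p k < p i" if "j < i" "i < k" "k \<le> n" for i k
  proof -
    have "1 \<le> j - 1" "j - 1 < i" "i \<in> {1..n}" using that assms(2,3) by auto
    moreover from this have "p (j - 1) < p i"
      using pj in_range[of i] inj_iff[of i "j - 1"] by (simp add: order_less_le)
    ultimately show ?thesis
      using no_123[of "j - 1" i k] inj_iff[of i k] that
      by (cases "p i" "p k" rule: linorder_cases) auto
  qed
  have "m < j"
  proof (rule ccontr)
    assume "\<not> m < j"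
    moreover have "m \<noteq> j" using inj_iff[of n 1] assms by (auto simp: m_def)
    ultimately have "j < m" by simp
    \<comment> \<open>\<open>m = p n\<close> is the least value beyond position \<open>j\<close>, so
      \<open>j < m\<close> would map the positions from \<open>j\<close> to \<open>n\<close>
      injectively into a set with one element less.\<close>
    have "p ` {j..n} \<subseteq> {Suc j..n}"
    proof
      fix y assume "y \<in> p ` {j..n}"
      then obtain i where i: "j \<le> i" "i \<le> n" "y = p i" by auto
      have "i = j \<or> i = n \<or> p n < p i" using i dec'[of i n] by linarith
      then have "j < y" using i \<open>j < m\<close> assms by (auto simp: m_def)
      then show "y \<in> {Suc j..n}" using i in_range[of i] assms by auto
    qed
    then have "card (p ` {j..n}) \<le> card {Suc j..n}" by (intro card_mono) auto
    moreover have "card (p ` {j..n}) = card {j..n}"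
      using inj_iff by (intro card_image inj_onI) simp
    ultimately show False using assms by simp
  qed
  have "j = n - 1"
  proof (rule ccontr)
    assume "j \<noteq> n - 1"
    then have j: "j < n - 1" using assms by simp
    have "n - 1 \<in> {1..n}" using n4 by auto
    then obtain t where t: "t < n" "cyc p t = n - 1" by (rule cyc_surj)
    have "t \<noteq> 0" using t n4 by (cases t) auto
    moreover have "t \<noteq> 1" "t \<noteq> 2" "t \<noteq> 3" using t(2) c1 c2 c3 j \<open>m < j\<close> n4 by auto
    ultimately have "3 < t" by linarith
    \<comment> \<open>The entries at these indices are \<open>j\<close>, \<open>m\<close> and
      \<open>n - 1\<close>, with \<open>m < j < n - 1\<close>.\<close>
    then show False using no_213[of 1 3 t] t c1 c3 \<open>m < j\<close> j by simp
  qed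
  have p1: "p 1 = n - 1" and pn1: "p (n - 1) = n" and pn2: "p (n - 2) = 1"
    using assms pj \<open>j = n - 1\<close> by (simp_all add: numeral_2_eq_2)
  have m_range: "1 \<le> m" "m \<le> n" using in_range[of n] n4 by (auto simp: m_def)
  have m1: "m \<noteq> 1" using inj_iff[of n "n - 2"] pn2 n4 by (auto simp: m_def)
  show ?thesis
  proof (cases "n = 4")
    case True
    then have "p 4 = 2" using m_range m1 \<open>m < j\<close> \<open>j = n - 1\<close> by (simp add: m_def)
    then have "p = id(1 := 3, 3 := 4, 4 := 2, 2 := 1)"
      using p1 pn1 pn2 outside True by (intro ext) (auto simp: numeral_eq_Suc le_Suc_eq)
    with True show ?thesis by (simp add: exceptional_def)
  next
    case False
    then have n5: "n \<ge> 5" using n4 by simp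
    have "m \<noteq> n - 2"
    proof
      assume "m = n - 2"
      then have "cyc p 4 = cyc p 0" using c3 cyc_Suc[of p 3] pn2 by (simp add: numeral_eq_Suc)
      then show False using cyc_inj[of 4 0] n5 by simp
    qed
    have "n - 2 \<in> {1..n}" using n5 by auto
    then obtain y where y: "y \<in> {1..n}" "p y = n - 2" by (rule preimage)
    have "y \<noteq> 1" "y \<noteq> n - 1" "y \<noteq> n"
      using y(2) p1 pn1 \<open>m \<noteq> n - 2\<close> n5 by (auto simp: m_def)
    \<comment> \<open>Such a \<open>y\<close> would give \<open>p y < p 2 < n - 1\<close>, so
      \<open>p y\<close> could not be \<open>n - 2\<close>.\<close>
    moreover have "\<not> (2 < y \<and> y < n - 1)"
      using dec[of 2 y] small[of 2] y(2) \<open>j = n - 1\<close> assms(2) by linarith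
    ultimately have "y = 2" using y(1) unfolding atLeastAtMost_iff by linarith
    with y have p2: "p 2 = n - 2" by simp
    \<comment> \<open>Otherwise 2 comes after \<open>m\<close> in the cycle, so its successor
      \<open>p 2 = n - 2\<close> would have to be less than \<open>m\<close>, or else be the closing
      1.\<close>
    have m2: "m = 2"
    proof (rule ccontr)
      assume "m \<noteq> 2"
      then have "m > 2" using m_range m1 by simp
      then have "s \<noteq> 3" using s c3 by auto
      then have "s > 3" using s3 by simp
      have cs: "cyc p (Suc s) = n - 2" using s p2 by (simp add: cyc_Suc)
      show False
      proof (cases "Suc s < n")
        case True
        then show False
          using small_after_two[of s 3 "Suc s"] s \<open>s > 3\<close> c3 \<open>m > 2\<close> cs \<open>m < j\<close> \<open>j = n - 1\<close> by simp
      next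
        case False
        then have "Suc s = n" using s by simp
        then show False using cs cyc_n n5 by simp
      qed
    qed
    have "cyc p 4 = n - 2" using c3 m2 p2 cyc_Suc[of p 3] by (simp add: numeral_eq_Suc)
    \<comment> \<open>The cycle closes after five steps.\<close>
    then have "cyc p 5 = cyc p 0" using pn2 cyc_Suc[of p 4] by (simp add: numeral_eq_Suc)
    then have "n = 5" using cyc_inj[of 5 0] n5 by (cases "n = 5") auto
    moreover have "p = id(1 := 4, 4 := 5, 5 := 2, 2 := 3, 3 := 1)"
      using p1 p2 pn1 pn2 m2 outside \<open>n = 5\<close>
      by (intro ext) (auto simp: numeral_eq_Suc le_Suc_eq m_def)
    ultimately show ?thesis by (simp add: exceptional_def)
  qed
qed

lemma exceptional_avoider:
  assumes "p \<in> exceptional n"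
  shows "p \<in> avoiders n"
proof -
  from assms consider "n = 4" "p = id(1 := 3, 3 := 4, 4 := 2, 2 := 1)"
    | "n = 5" "p = id(1 := 4, 4 := 5, 5 := 2, 2 := 3, 3 := 1)"
    by (auto simp: exceptional_def split: if_splits)
  then show ?thesis
  proof cases
    case 1
    have p: "p 1 = 3" "p 2 = 1" "p 3 = 4" "p 4 = 2" using 1 by simp_all
    have c: "cyc p 1 = 3" "cyc p 2 = 4" "cyc p 3 = 2" "cyc p 4 = 1"
      using 1 by (simp_all add: cyc_def numeral_eq_Suc)
    have "{..<4::nat} = {0, 1, 2, 3}" "{1..4::nat} = {1, 2, 3, 4}" by auto
    then have "cyc p ` {..<4} = {1..4}" using c by auto
    moreover have "\<forall>x. x \<notin> {1..4} \<longrightarrow> p x = x" using 1 by auto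
    moreover have False
      if ijk: "1 \<le> i \<and> i < j \<and> j < k \<and> k \<le> 4" and inc: "p i < p j \<and> p j < p k" for i j k
    proof -
      from ijk have "i = 1 \<or> i = 2" "j = 2 \<or> j = 3" "k = 3 \<or> k = 4" by linarith+
      then show False using ijk inc p by (elim disjE) simp_all
    qed
    moreover have False
      if ijk: "i < j \<and> j < k \<and> k < 4" and pat: "cyc p j < cyc p i \<and> cyc p i < cyc p k" for i j k
    proof -
      from ijk have "i = 0 \<or> i = 1" "j = 1 \<or> j = 2" "k = 2 \<or> k = 3" by linarith+
      then show False
        using ijk pat by (elim disjE) (simp_all add: c c[unfolded One_nat_def])
    qed
    moreover have "(1::nat) \<le> 4" by simp
    ultimately show ?thesis
      unfolding \<open>n = 4\<close> using c avoiders_iff[of 4 p] by blast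
  next
    case 2
    have p: "p 1 = 4" "p 2 = 3" "p 3 = 1" "p 4 = 5" "p 5 = 2" using 2 by simp_all
    have c: "cyc p 1 = 4" "cyc p 2 = 5" "cyc p 3 = 2" "cyc p 4 = 3" "cyc p 5 = 1"
      using 2 by (simp_all add: cyc_def numeral_eq_Suc)
    have "{..<5::nat} = {0, 1, 2, 3, 4}" "{1..5::nat} = {1, 2, 3, 4, 5}" by auto
    then have "cyc p ` {..<5} = {1..5}" using c by auto
    moreover have "\<forall>x. x \<notin> {1..5} \<longrightarrow> p x = x" using 2 by auto
    moreover have False
      if ijk: "1 \<le> i \<and> i < j \<and> j < k \<and> k \<le> 5" and inc: "p i < p j \<and> p j < p k" for i j k
    proof -
      from ijk have "i = 1 \<or> i = 2 \<or> i = 3" "j = 2 \<or> j = 3 \<or> j = 4" "k = 3 \<or> k = 4 \<or> k = 5"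
        by linarith+
      then show False using ijk inc p by (elim disjE) simp_all
    qed
    moreover have False
      if ijk: "i < j \<and> j < k \<and> k < 5" and pat: "cyc p j < cyc p i \<and> cyc p i < cyc p k" for i j k
    proof -
      from ijk have "i = 0 \<or> i = 1 \<or> i = 2" "j = 1 \<or> j = 2 \<or> j = 3" "k = 2 \<or> k = 3 \<or> k = 4"
        by linarith+
      then show False
        using ijk pat by (elim disjE) (simp_all add: c c[unfolded One_nat_def])
    qed
    moreover have "(1::nat) \<le> 5" by simp
    ultimately show ?thesis
      unfolding \<open>n = 5\<close> using c avoiders_iff[of 5 p] by blast
  qed
qed

section \<open>Passing between sizes \<open>m\<close> and \<open>m + 2\<close>\<close>

text \<open>Relabelling of values when every position moves up by one. The value 1 stays, because it
  has to close the new cycle; this leaves the value 2 free for the last position.\<close>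

definition lift :: "nat \<Rightarrow> nat" where
  "lift y = (if y = 1 then 1 else y + 1)"

definition lower :: "nat \<Rightarrow> nat" where
  "lower y = (if y = 1 then 1 else y - 1)"

lemma lift_less_iff: "\<lbrakk>1 \<le> x; 1 \<le> y\<rbrakk> \<Longrightarrow> lift x < lift y \<longleftrightarrow> x < y"
  by (auto simp: lift_def)

lemma lift_eq_iff: "\<lbrakk>1 \<le> x; 1 \<le> y\<rbrakk> \<Longrightarrow> lift x = lift y \<longleftrightarrow> x = y"
  by (auto simp: lift_def)

text \<open>The converse fails, as \<open>lower\<close> sends both 1 and 2 to 1.\<close>

lemma lower_less_imp_less: "lower x < lower y \<Longrightarrow> 1 \<le> x \<Longrightarrow> x < y"
  by (auto simp: lower_def split: if_splits)

lemma lift_lower: "\<lbrakk>1 \<le> y; y \<noteq> 2\<rbrakk> \<Longrightarrow> lift (lower y) = y"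
  by (auto simp: lift_def lower_def)

text \<open>If \<open>C(p) = (1, c\<^sub>2, \<dots>, c\<^sub>m)\<close>, then
  \<open>C(extend m p) = (1, m + 2, 2, c\<^sub>2 + 1, \<dots>, c\<^sub>m + 1)\<close>.\<close>

definition extend :: "nat \<Rightarrow> (nat \<Rightarrow> nat) \<Rightarrow> nat \<Rightarrow> nat" where
  "extend m p i =
     (if i = 1 then m + 2
      else if i = m + 2 then 2
      else if i \<in> {2..m + 1} then lift (p (i - 1))
      else i)"

lemma (in avoider) cyc_extend:
  "i < n \<Longrightarrow> cyc (extend n p) (i + 2) = cyc p i + 1"
proof (induction i)
  case 0
  have "extend n p 1 = n + 2" "extend n p (n + 2) = 2" by (simp_all add: extend_def)
  then show ?case using cyc_2[of "extend n p"] by (simp add: numeral_2_eq_2)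
next
  case (Suc i)
  have "cyc p i \<in> {1..n}" using cyc_range[of i] Suc.prems by simp
  then have "extend n p (cyc p i + 1) = lift (cyc p (Suc i))"
    by (simp add: extend_def cyc_Suc)
  then have "cyc (extend n p) (Suc i + 2) = lift (cyc p (Suc i))"
    using Suc.IH Suc.prems cyc_Suc[of "extend n p" "i + 2"] by simp
  \<comment> \<open>The entry at index \<open>Suc i < n\<close> is not 1, so \<open>lift\<close>
    adds one.\<close>
  also have "\<dots> = cyc p (Suc i) + 1"
    using Suc.prems cyc_inj[of "Suc i" 0] by (simp add: lift_def)
  finally show ?case .
qed

text \<open>The new entries join no pattern: in one-line notation the maximum comes first, and the 2
  in last place has only one smaller value; in the cycle notation the leading 1 and
  \<open>n + 2\<close> cannot be the 2 of a 213. The other entries keep their relative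
  order.\<close>

lemma (in avoider) extend_avoider:
  "extend n p \<in> avoiders (n + 2)"
proof -
  let ?e = "extend n p"
  have c1: "cyc ?e 1 = n + 2" using cyc_1[of ?e] by (simp add: extend_def)
  have e_mid: "?e i = lift (p (i - 1))" if "2 \<le> i" "i \<le> n + 1" for i
    using that by (simp add: extend_def)
  have "cyc ?e ` {..<n + 2} = {1..n + 2}"
  proof
    have "cyc ?e i \<in> {1..n + 2}" if "i < n + 2" for i
    proof -
      consider "i = 0" | "i = 1" | l where "i = l + 2"
        by (metis One_nat_def add_2_eq_Suc' not0_implies_Suc)
      then show ?thesis
      proof cases
        case (3 l)
        then show ?thesis using cyc_extend[of l] cyc_range[of l] that by simp
      qed (use c1 in simp_all)
    qed
    then show "cyc ?e ` {..<n + 2} \<subseteq> {1..n + 2}" by blast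
    show "{1..n + 2} \<subseteq> cyc ?e ` {..<n + 2}"
    proof
      fix x assume x: "x \<in> {1..n + 2}"
      consider "x = 1" | "x = n + 2" | "2 \<le> x" "x \<le> n + 1" using x by force
      then show "x \<in> cyc ?e ` {..<n + 2}"
      proof cases
        case 1
        then show ?thesis by (intro image_eqI[of _ _ 0]) auto
      next
        case 2
        then show ?thesis using c1 by (intro image_eqI[of _ _ 1]) auto
      next
        case 3
        then have "x - 1 \<in> {1..n}" by auto
        then obtain i where "i < n" "cyc p i = x - 1" using cyc_surj by blast
        then show ?thesis using 3 cyc_extend[of i] by (intro image_eqI[of _ _ "i + 2"]) auto
      qed
    qed
  qed
  moreover have "cyc ?e (n + 2) = 1"
  proof -
    have "cyc ?e (n + 2) = ?e (cyc ?e (n - 1 + 2))" using n_pos by (simp flip: cyc_Suc)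
    also have "\<dots> = ?e (cyc p (n - 1) + 1)" using cyc_extend[of "n - 1"] n_pos by simp
    also have "\<dots> = lift (p (cyc p (n - 1)))"
      using e_mid[of "cyc p (n - 1) + 1"] cyc_range[of "n - 1"] by simp
    also have "\<dots> = 1" using p_cyc_last by (simp add: lift_def)
    finally show ?thesis .
  qed
  moreover have False
    if ijk: "1 \<le> i \<and> i < j \<and> j < k \<and> k \<le> n + 2" and inc: "?e i < ?e j \<and> ?e j < ?e k" for i j k
  proof -
    have le: "?e x \<in> {1..n + 2}" if "x \<in> {1..n + 2}" for x
    proof (cases "x = 1 \<or> x = n + 2")
      case True
      then show ?thesis by (auto simp: extend_def)
    next
      case False
      then have x: "2 \<le> x" "x \<le> n + 1" "x - 1 \<in> {1..n}" using that by auto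
      then show ?thesis using e_mid[OF x(1,2)] in_range[OF x(3)] by (auto simp: lift_def)
    qed
    have "?e j \<le> n + 2" using le[of j] ijk by simp
    then have "i \<noteq> 1" using inc by (auto simp: extend_def)
    have "?e i \<ge> 1" using le[of i] ijk by simp
    then have "k \<noteq> n + 2" using inc by (auto simp: extend_def)
    have "i - 1 \<in> {1..n}" "j - 1 \<in> {1..n}" "k - 1 \<in> {1..n}"
      using ijk \<open>i \<noteq> 1\<close> \<open>k \<noteq> n + 2\<close> by auto
    note this[THEN in_range]
    then have "p (i - 1) < p (j - 1)" "p (j - 1) < p (k - 1)"
      using inc ijk \<open>i \<noteq> 1\<close> \<open>k \<noteq> n + 2\<close> by (simp_all add: e_mid lift_less_iff)
    moreover have "1 \<le> i - 1" "i - 1 < j - 1" "j - 1 < k - 1" "k - 1 \<le> n"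
      using ijk \<open>i \<noteq> 1\<close> \<open>k \<noteq> n + 2\<close> by linarith+
    ultimately show False using no_123 by blast
  qed
  moreover have False
    if ijk: "i < j \<and> j < k \<and> k < n + 2" and pat: "cyc ?e j < cyc ?e i \<and> cyc ?e i < cyc ?e k" for i j k
  proof -
    have range: "cyc ?e x \<in> {1..n + 2}" if "x < n + 2" for x
      using that calculation(1) by blast
    have "i \<noteq> 0" using range[of j] pat ijk by (cases i) auto
    moreover have "i \<noteq> 1" using range[of k] pat ijk c1 by auto
    ultimately have "2 \<le> i" by simp
    have shift: "cyc ?e l = cyc p (l - 2) + 1" if "2 \<le> l" "l < n + 2" for l
    proof -
      have "l - 2 < n" "l - 2 + 2 = l" using that by linarith+
      then show ?thesis using cyc_extend by metis
    qed
    have "cyc p (j - 2) < cyc p (i - 2)" "cyc p (i - 2) < cyc p (k - 2)"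
      using pat ijk \<open>2 \<le> i\<close> by (simp_all add: shift)
    moreover have "i - 2 < j - 2" "j - 2 < k - 2" "k - 2 < n" using ijk \<open>2 \<le> i\<close> by linarith+
    ultimately show False using no_213 by blast
  qed
  moreover have "\<forall>x. x \<notin> {1..n + 2} \<longrightarrow> ?e x = x" by (auto simp: extend_def)
  moreover have "1 \<le> n + 2" by simp
  ultimately show ?thesis using avoiders_iff[of "n + 2" ?e] by blast
qed

text \<open>The preimage \<open>r\<close> arises by deleting 1 and \<open>m + 2\<close> from the
  cycle notation of \<open>p\<close> and lowering the remaining entries by one.\<close>

lemma extend_surj:
  assumes m: "m \<ge> 1" and p: "p \<in> avoiders (m + 2)" "p 1 = m + 2" "p (m + 2) = 2"
  obtains r where "r \<in> avoiders m" "extend m r = p"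
proof -
  interpret avoider "m + 2" p using p by unfold_locales auto
  define r where "r i = (if i \<in> {1..m} then lower (p (i + 1)) else i)" for i
  have c1: "cyc p 1 = m + 2" and c2: "cyc p 2 = 2" using p cyc_1[of p] cyc_2[of p] by simp_all
  have mid: "cyc p (i + 2) \<in> {2..m + 1}" if "i < m" for i
    using that cyc_range[of "i + 2"] cyc_inj[of "i + 2" 0] cyc_inj[of "i + 2" 1] c1 by auto
  \<comment> \<open>Stated with \<open>lower\<close> rather than subtraction in order to cover
    \<open>i = m - 1\<close>, where the next entry is the closing 1.\<close>
  have step: "cyc r (Suc i) = lower (cyc p (i + 3))" if "i < m" "cyc r i = cyc p (i + 2) - 1" for i
  proof -
    have "cyc p (i + 3) = p (cyc p (i + 2))" by (simp add: numeral_eq_Suc cyc_Suc)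
    then show ?thesis using that mid[of i] by (auto simp: cyc_Suc r_def)
  qed
  have cr: "cyc r i = cyc p (i + 2) - 1" if "i < m" for i
    using that
  proof (induction i)
    case 0
    then show ?case using c2 by (simp add: numeral_2_eq_2)
  next
    case (Suc i)
    then have "cyc r (Suc i) = lower (cyc p (Suc i + 2))" using step[of i] by (simp add: numeral_eq_Suc)
    then show ?case using mid[of "Suc i"] Suc.prems by (auto simp: lower_def)
  qed
  have "cyc r ` {..<m} = {1..m}"
  proof
    show "cyc r ` {..<m} \<subseteq> {1..m}" using mid by (force simp: cr)
    show "{1..m} \<subseteq> cyc r ` {..<m}"
    proof
      fix x assume x: "x \<in> {1..m}"
      obtain i where i: "i < m + 2" "cyc p i = x + 1" using cyc_surj[of "x + 1"] x by auto
      have "i \<noteq> 0" "i \<noteq> 1" using i x c1 by (rule_tac notI, simp)+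
      then show "x \<in> cyc r ` {..<m}" using i cr[of "i - 2"]
        by (intro image_eqI[of _ _ "i - 2"]) (auto simp del: add_2_eq_Suc')
    qed
  qed
  moreover have "cyc r m = 1"
  proof -
    have "cyc r m = lower (cyc p (m + 2))"
      using step[of "m - 1"] cr[of "m - 1"] m by (simp add: numeral_eq_Suc)
    then show ?thesis using cyc_n by (simp add: lower_def)
  qed
  moreover have False
    if ijk: "1 \<le> i \<and> i < j \<and> j < k \<and> k \<le> m" and inc: "r i < r j \<and> r j < r k" for i j k
    using that no_123[of "i + 1" "j + 1" "k + 1"] in_range[of "i + 1"] in_range[of "j + 1"]
    by (auto simp: r_def dest!: lower_less_imp_less)
  moreover have False
    if "i < j \<and> j < k \<and> k < m" "cyc r j < cyc r i \<and> cyc r i < cyc r k" for i j k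
  proof -
    have "cyc p (j + 2) < cyc p (i + 2)" "cyc p (i + 2) < cyc p (k + 2)"
      using that by (auto simp: cr simp del: add_2_eq_Suc')
    then show False using no_213[of "i + 2" "j + 2" "k + 2"] that by simp
  qed
  moreover have "\<forall>x. x \<notin> {1..m} \<longrightarrow> r x = x" by (auto simp: r_def)
  ultimately have "r \<in> avoiders m" using avoiders_iff[OF m, of r] by blast
  moreover have "extend m r = p"
  proof
    fix i
    consider "i = 1" | "i = m + 2" | "2 \<le> i" "i \<le> m + 1" | "i \<notin> {1..m + 2}" by force
    then show "extend m r i = p i"
    proof cases
      case 3
      \<comment> \<open>The value 2 belongs to position \<open>m + 2\<close>, so \<open>lift\<close>
        undoes \<open>lower\<close> here.\<close>
      then have "p i \<ge> 1" "p i \<noteq> 2" using p in_range[of i] inj_iff[of i "m + 2"] by auto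
      then show ?thesis using 3 by (auto simp: extend_def r_def lift_lower)
    qed (use p outside in \<open>auto simp: extend_def\<close>)
  qed
  ultimately show ?thesis by (rule that)
qed

lemma inj_on_extend:
  assumes "m \<ge> 1"
  shows "inj_on (extend m) (avoiders m)"
proof (intro inj_onI ext)
  fix p r i
  assume p: "p \<in> avoiders m" and r: "r \<in> avoiders m" and eq: "extend m p = extend m r"
  interpret P: avoider m p using p assms by unfold_locales
  interpret R: avoider m r using r assms by unfold_locales
  show "p i = r i"
  proof (cases "i \<in> {1..m}")
    case True
    then have "lift (p i) = lift (r i)" using fun_cong[OF eq, of "i + 1"] by (simp add: extend_def)
    then show ?thesis
      using P.in_range[OF True] R.in_range[OF True] by (simp add: lift_eq_iff)
  next
    case False
    then show ?thesis using P.outside R.outside by metis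
  qed
qed

section \<open>The recurrence and the count\<close>

lemma finite_avoiders: "finite (avoiders n)"
  by (rule finite_subset[OF _ finite_permutations[of "{1..n}"]]) (auto simp: cyclic_avoiders_def)

lemma avoiders_split:
  assumes "m \<ge> 1"
  shows "avoiders (m + 2) = extend m ` avoiders m \<union> {zigzag (m + 2)} \<union> exceptional (m + 2)"
proof
  show "avoiders (m + 2) \<subseteq> extend m ` avoiders m \<union> {zigzag (m + 2)} \<union> exceptional (m + 2)"
  proof
    fix p assume p: "p \<in> avoiders (m + 2)"
    interpret avoider "m + 2" p using p by unfold_locales auto
    have n3: "m + 2 \<ge> 3" using assms by simp
    show "p \<in> extend m ` avoiders m \<union> {zigzag (m + 2)} \<union> exceptional (m + 2)"
    proof (cases "p 1 = m + 2")
      case True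
      then show ?thesis using extend_surj[OF assms p True two_third[OF n3 True]] by blast
    next
      case False
      then have pp: "p (p 1) = m + 2" using n_second_or_third[OF n3] by simp
      have "p 1 \<in> {1..m + 2}" by (rule in_range) simp
      moreover have "p 1 \<noteq> 1" using pp n3 by auto
      ultimately consider "p 1 = 2" | "2 < p 1" "p 1 < m + 2" using False by force
      then show ?thesis
      proof cases
        case 1
        then show ?thesis using eq_zigzag[OF n3] pp by simp
      next
        case 2
        then show ?thesis using in_exceptional[OF refl] pp by simp
      qed
    qed
  qed
  have "extend m p \<in> avoiders (m + 2)" if "p \<in> avoiders m" for p
  proof -
    interpret avoider m p using that assms by unfold_locales
    show ?thesis by (rule extend_avoider)
  qed
  then show "extend m ` avoiders m \<union> {zigzag (m + 2)} \<union> exceptional (m + 2) \<subseteq> avoiders (m + 2)"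
    using zigzag_avoider[of "m + 2"] exceptional_avoider assms by auto
qed

text \<open>The three classes of \<open>avoiders_split\<close> are disjoint because they differ in
  the value at 1: it is \<open>m + 2\<close>, 2, or \<open>m + 1 > 2\<close>.\<close>

lemma card_avoiders_rec:
  assumes "m \<ge> 1"
  shows "card (avoiders (m + 2)) = card (avoiders m) + 1 + (if m = 2 \<or> m = 3 then 1 else 0)"
proof -
  have first: "extend m p 1 = m + 2" "zigzag (m + 2) 1 = 2" for p
    by (simp_all add: extend_def zigzag_def)
  have exc: "p 1 = m + 1 \<and> 2 < p 1" if "p \<in> exceptional (m + 2)" for p
    using that by (auto simp: exceptional_def split: if_splits)
  have "zigzag (m + 2) \<notin> extend m ` avoiders m"
    using first assms by force
  then have "card (extend m ` avoiders m \<union> {zigzag (m + 2)}) = card (avoiders m) + 1"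
    using card_image[OF inj_on_extend[OF assms]] finite_avoiders[of m] by simp
  moreover have "card (exceptional (m + 2)) = (if m = 2 \<or> m = 3 then 1 else 0)"
    by (auto simp: exceptional_def)
  moreover have "card (avoiders (m + 2)) =
      card (extend m ` avoiders m \<union> {zigzag (m + 2)}) + card (exceptional (m + 2))"
    unfolding avoiders_split[OF assms]
  proof (rule card_Un_disjoint)
    show "(extend m ` avoiders m \<union> {zigzag (m + 2)}) \<inter> exceptional (m + 2) = {}"
      using first exc by force
    show "finite (extend m ` avoiders m \<union> {zigzag (m + 2)})"
      using finite_avoiders by simp
    show "finite (exceptional (m + 2))" by (simp add: exceptional_def)
  qed
  ultimately show ?thesis by (simp only:)
qed

lemma avoiders_1: "avoiders 1 = {id}"
proof -
  have "p \<in> avoiders 1 \<longleftrightarrow> p = id" for p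
  proof
    assume "p \<in> avoiders 1"
    then show "p = id" by (simp add: cyclic_avoiders_def)
  next
    assume "p = id"
    then show "p \<in> avoiders 1" by (subst avoiders_iff) (auto simp: cyc_def)
  qed
  then show ?thesis by blast
qed

lemma avoiders_2: "avoiders 2 = {id(1 := 2, 2 := 1)}"
proof -
  have "p = id(1 := 2, 2 := 1)" if "p \<in> avoiders 2" for p
  proof -
    interpret avoider 2 p using that by unfold_locales auto
    have "p 1 \<noteq> 1" using cyc_inj[of 1 0] cyc_1[of p] by auto
    then have "p 1 = 2" using in_range[of 1] by force
    moreover have "p 2 = 1" using cyc_n cyc_2[of p] calculation by simp
    ultimately show ?thesis using outside by (intro ext) (auto simp: le_Suc_eq numeral_2_eq_2)
  qed
  moreover have "id(1 := 2, 2 := 1) \<in> avoiders 2"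
  proof -
    let ?p = "id(1 := 2, 2 := 1 :: nat)"
    have "{..<2::nat} = {0, 1}" "{1..2::nat} = {1, 2}" by auto
    moreover have "cyc ?p 1 = 2" "cyc ?p 2 = 1" using cyc_1[of ?p] cyc_2[of ?p] by simp_all
    ultimately show ?thesis by (subst avoiders_iff) auto
  qed
  ultimately show ?thesis by blast
qed

text \<open>For sizes 1, 2 and 3 the count is one below this formula; the exceptional permutations
  of sizes 4 and 5 make up the difference. Sizes 4 and 5 are therefore computed from sizes 2 and 1,
  and the induction starts at 6.\<close>

lemma card_avoiders:
  assumes "n \<ge> 4"
  shows "card (avoiders n) = (n + 1) div 2 + 1"
  using assms
proof (induction n rule: less_induct)
  case (less n)
  have card_1: "card (avoiders 1) = 1" and card_2: "card (avoiders 2) = 1"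
    unfolding avoiders_1 avoiders_2 by simp_all
  consider "n = 4" | "n = 5" | "n \<ge> 6" using less.prems by linarith
  then show ?case
  proof cases
    case 1
    then show ?thesis using card_avoiders_rec[of 2] card_2 by simp
  next
    case 2
    then show ?thesis using card_avoiders_rec[of 1] card_avoiders_rec[of 3] card_1
      by (simp flip: One_nat_def)
  next
    case 3
    then have "n = n - 2 + 2" "n - 2 \<ge> 4" by simp_all
    then obtain m where m: "n = m + 2" "m \<ge> 4" by blast
    then show ?thesis using less.IH[of m] card_avoiders_rec[of m] by simp
  qed
qed

theorem theorem3p5:
  fixes n :: nat
  assumes "n \<ge> 4"
  shows "int (num_cyclic_avoiders n [1, 2, 3] [2, 1, 3]) = \<lceil>real n / 2\<rceil> + 1"
proof -
  have "\<lceil>real n / 2\<rceil> = int ((n + 1) div 2)"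
    by linarith
  then show ?thesis
    using card_avoiders[OF assms] by (simp add: num_cyclic_avoiders_def)
qed

end
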